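(* A separable operator space $X$ has a cb-frame if and only if $X$ has the completely bounded approximation property (CBAP).
   Context: Operator spaces are norm-complete, and $\|\cdot\|_{cb}$ is the completely bounded norm. Let $X$ be an operator space with dual $X^*$; for $y\in X$, $g\in X^*$, $y\otimes g$ denotes the map $x\mapsto g(x)y$. A sequence $(x_n,f_n)_{n\in\mathbb{N}}\subset X\times X^*$ is a cb-frame for $X$ if $x=\sum_{n=1}^\infty f_n(x)x_n$ (norm convergent) for all $x\in X$, and the partial sums $S_m=\sum_{n=1}^m x_n\otimes f_n$ satisfy $\sup_m\|S_m\|_{cb}<\infty$. A separable operator space $X$ has the CBAP if there is a sequence of finite-rank maps $\Phi_k:X\to X$ with $\sup_k\|\Phi_k\|_{cb}<\infty$ and $\Phi_k(x)\to x$ in norm for every $x\in X$. *)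

theory Defs
  imports "HOL-Analysis.Analysis" "Jordan_Normal_Form.Matrix"
begin

unbundle no vec_syntax
hide_const (open) Finite_Cartesian_Product.vec

class complex_banach = banach +
  fixes scaleC :: "complex \<Rightarrow> 'a \<Rightarrow> 'a"  (infixr \<open>*\<^sub>C\<close> 75)
  assumes scaleC_add_right: "c *\<^sub>C (x + y) = c *\<^sub>C x + c *\<^sub>C y"
    and scaleC_add_left: "(b + c) *\<^sub>C x = b *\<^sub>C x + c *\<^sub>C x"
    and scaleC_scaleC: "b *\<^sub>C (c *\<^sub>C x) = (b * c) *\<^sub>C x"
    and scaleC_of_real: "complex_of_real r *\<^sub>C x = r *\<^sub>R x"
    and norm_scaleC: "norm (c *\<^sub>C x) = cmod c * norm x"

global_interpretation complex_banach:
  vector_space "scaleC :: complex \<Rightarrow> 'a \<Rightarrow> 'a::complex_banach"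
proof
  show "1 *\<^sub>C x = x" for x :: 'a
    using scaleC_of_real[of 1 x] by simp
qed (simp_all add: scaleC_add_right scaleC_add_left scaleC_scaleC)

text \<open>The norm of a scalar matrix as an operator between the spaces \<open>\<ell>\<^sub>2\<^sup>n\<close>.\<close>

definition l2_norm :: "complex vec \<Rightarrow> real" where
  "l2_norm v = L2_set (\<lambda>i. cmod (v $ i)) {..<dim_vec v}"

definition mat_opnorm :: "complex mat \<Rightarrow> real" where
  "mat_opnorm A = (SUP v \<in> {v \<in> carrier_vec (dim_col A). l2_norm v \<le> 1}. l2_norm (A *\<^sub>v v))"

text \<open>The product \<open>\<alpha> x \<beta>\<close> of scalar matrices \<open>\<alpha>, \<beta>\<close> with a matrix \<open>x\<close> over a vector space.\<close>

definition bimod_mult :: "complex mat \<Rightarrow> 'a::complex_banach mat \<Rightarrow> complex mat \<Rightarrow> 'a mat" where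
  "bimod_mult \<alpha> x \<beta> = mat (dim_row \<alpha>) (dim_col \<beta>)
     (\<lambda>(i, j). \<Sum>k<dim_row x. \<Sum>l<dim_col x. (\<alpha> $$ (i, k) * \<beta> $$ (l, j)) *\<^sub>C (x $$ (k, l)))"

definition direct_sum_mat :: "'a::zero mat \<Rightarrow> 'a mat \<Rightarrow> 'a mat" where
  "direct_sum_mat x y =
     four_block_mat x (0\<^sub>m (dim_row x) (dim_col y)) (0\<^sub>m (dim_row y) (dim_col x)) y"

text \<open>
  Complete abstract operator spaces: \<open>mnorm\<close> restricted to \<open>carrier_mat n n\<close> is the norm on
  \<open>M\<^sub>n(X)\<close>, and the last two axioms are Ruan's axioms.  Only square matrices matter.  The case
  \<open>n = 0\<close> is included for convenience: the zero space \<open>M\<^sub>0(X)\<close> imposes no restriction.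
\<close>

locale operator_space =
  fixes mnorm :: "'a::complex_banach mat \<Rightarrow> real"
  assumes mnorm_eq_0_iff: "x \<in> carrier_mat n n \<Longrightarrow> mnorm x = 0 \<longleftrightarrow> x = 0\<^sub>m n n"
    and mnorm_triangle:
      "x \<in> carrier_mat n n \<Longrightarrow> y \<in> carrier_mat n n \<Longrightarrow> mnorm (x + y) \<le> mnorm x + mnorm y"
    and mnorm_scaleC: "x \<in> carrier_mat n n \<Longrightarrow> mnorm (map_mat (scaleC c) x) = cmod c * mnorm x"
    and mnorm_1: "mnorm (mat 1 1 (\<lambda>_. a)) = norm a"
    and mnorm_direct_sum:
      "x \<in> carrier_mat m m \<Longrightarrow> y \<in> carrier_mat n n \<Longrightarrow>
         mnorm (direct_sum_mat x y) = max (mnorm x) (mnorm y)"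
    and mnorm_bimod_mult:
      "x \<in> carrier_mat m m \<Longrightarrow> \<alpha> \<in> carrier_mat n m \<Longrightarrow> \<beta> \<in> carrier_mat m n \<Longrightarrow>
         mnorm (bimod_mult \<alpha> x \<beta>) \<le> mat_opnorm \<alpha> * mnorm x * mat_opnorm \<beta>"

text \<open>For matrix norms \<open>N\<close> on \<open>X\<close> and \<open>N'\<close> on \<open>Y\<close>, \<open>amp_norm N N' n \<phi>\<close> is the operator norm of the
  amplification \<open>\<phi>\<^sub>n : M\<^sub>n(X) \<rightarrow> M\<^sub>n(Y)\<close>; it may be infinite.\<close>

definition amp_norm ::
  "('a mat \<Rightarrow> real) \<Rightarrow> ('b mat \<Rightarrow> real) \<Rightarrow> nat \<Rightarrow> ('a \<Rightarrow> 'b) \<Rightarrow> ennreal" where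
  "amp_norm N N' n \<phi> = (SUP x \<in> {x \<in> carrier_mat n n. N x \<le> 1}. ennreal (N' (map_mat \<phi> x)))"

definition cb_norm :: "('a mat \<Rightarrow> real) \<Rightarrow> ('b mat \<Rightarrow> real) \<Rightarrow> ('a \<Rightarrow> 'b) \<Rightarrow> ennreal" where
  "cb_norm N N' \<phi> = (SUP n. amp_norm N N' n \<phi>)"

definition dual_space :: "('a::complex_banach \<Rightarrow> complex) set" where
  "dual_space = {f. bounded_linear f \<and> (\<forall>c x. f (c *\<^sub>C x) = c * f x)}"

definition rank_one :: "'a::complex_banach \<Rightarrow> ('a \<Rightarrow> complex) \<Rightarrow> 'a \<Rightarrow> 'a" where
  "rank_one y g = (\<lambda>x. g x *\<^sub>C y)"

definition cb_frame ::
  "('a::complex_banach mat \<Rightarrow> real) \<Rightarrow> (nat \<Rightarrow> 'a \<times> ('a \<Rightarrow> complex)) \<Rightarrow> bool" where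
  "cb_frame N F \<longleftrightarrow>
     (\<forall>n. snd (F n) \<in> dual_space) \<and>
     (\<forall>x. (\<lambda>n. snd (F n) x *\<^sub>C fst (F n)) sums x) \<and>
     (SUP m. cb_norm N N (\<lambda>x. \<Sum>n<m. rank_one (fst (F n)) (snd (F n)) x)) < \<infinity>"

definition finite_rank :: "('a::complex_banach \<Rightarrow> 'b::complex_banach) \<Rightarrow> bool" where
  "finite_rank \<Phi> \<longleftrightarrow> Vector_Spaces.linear scaleC scaleC \<Phi> \<and>
     (\<exists>B. finite B \<and> range \<Phi> \<subseteq> complex_banach.span B)"

definition CBAP :: "('a::complex_banach mat \<Rightarrow> real) \<Rightarrow> bool" where
  "CBAP N \<longleftrightarrow> (\<exists>\<Phi> :: nat \<Rightarrow> 'a \<Rightarrow> 'a.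
     (\<forall>k. finite_rank (\<Phi> k)) \<and>
     (SUP k. cb_norm N N (\<Phi> k)) < \<infinity> \<and>
     (\<forall>x. (\<lambda>k. \<Phi> k x) \<longlonglongrightarrow> x))"

end

theory Submission
  imports Defs
begin

text \<open>
  The partial sums of a cb-frame witness the CBAP.  Conversely, let \<open>\<Phi>\<^sub>k\<close> witness the CBAP.  Each
  difference \<open>\<Phi>\<^sub>k - \<Phi>\<^sub>k\<^sub>-\<^sub>1\<close> is a finite sum of rank-one maps \<open>y \<otimes> g\<close> with \<open>g\<close> bounded, and such maps
  are completely bounded.  The intermediate sums of this decomposition may have large cb-norm, so it
  is divided by a large \<open>N\<close> and run through \<open>N\<close> times.  Concatenating these lists gives a sequence
  whose partial sums are convex combinations of \<open>\<Phi>\<^sub>k\<^sub>-\<^sub>1\<close> and \<open>\<Phi>\<^sub>k\<close> up to an error of cb-norm at most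
  \<open>1/(k+1)\<close>.
\<close>

section \<open>Finite-rank maps on complex Banach spaces\<close>

lemma scaleC_scaleR: "c *\<^sub>C (r *\<^sub>R x) = r *\<^sub>R (c *\<^sub>C (x::'a::complex_banach))"
  by (simp add: scaleC_of_real[symmetric] scaleC_scaleC mult.commute)

text \<open>A ball around \<open>b\<close> misses the closed span, and its radius serves as
  \<delta>: dividing \<open>v\<close> by a nonzero \<open>c\<close> gives \<open>b\<close> minus an
  element of the span. This makes coordinate functionals continuous without the Hahn-Banach
  theorem.\<close>

lemma coefficient_bound_outside_span:
  fixes b :: "'a::complex_banach"
  assumes "closed (complex_banach.span B)" and "b \<notin> complex_banach.span B"
  obtains \<delta> where "\<delta> > 0"
    and "\<And>c v. v - c *\<^sub>C b \<in> complex_banach.span B \<Longrightarrow> \<delta> * cmod c \<le> norm v"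
proof -
  obtain e where e: "e > 0" "ball b e \<subseteq> - complex_banach.span B"
    using assms by (meson ComplI open_Compl open_contains_ball)
  have "e * cmod c \<le> norm v" if v: "v - c *\<^sub>C b \<in> complex_banach.span B" for c v
  proof (cases "c = 0")
    case False
    define w where "w = (- inverse c) *\<^sub>C (v - c *\<^sub>C b)"
    have "w \<in> complex_banach.span B"
      unfolding w_def by (rule complex_banach.span_scale[OF v])
    then have "e \<le> norm (b - w)"
      using e(2) by (auto simp: subset_iff dist_norm not_less)
    also have "b - w = inverse c *\<^sub>C v"
      using False by (simp add: w_def complex_banach.scale_right_diff_distrib)
    finally show ?thesis
      using False by (simp add: norm_scaleC norm_inverse norm_divide field_simps)
  qed simp
  with e(1) show ?thesis
    by (rule that)
qed

text \<open>Vectors are added one at a time. Along a convergent sequence the coefficient of a new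
  vector \<open>b\<close> is Cauchy by \<open>coefficient_bound_outside_span\<close>; subtracting
  the multiples of \<open>b\<close> leaves a convergent sequence in the smaller span, closed by
  induction.\<close>

lemma closed_span_finite:
  fixes B :: "'a::complex_banach set"
  assumes "finite B"
  shows "closed (complex_banach.span B)"
  using assms
proof (induction B)
  case (insert b B)
  show ?case
  proof (cases "b \<in> complex_banach.span B")
    case True
    then show ?thesis
      using insert.IH by (simp add: complex_banach.span_redundant)
  next
    case False
    from insert.IH this obtain \<delta> where \<delta>: "\<delta> > 0"
      and bound: "\<And>c v. v - c *\<^sub>C b \<in> complex_banach.span B \<Longrightarrow> \<delta> * cmod c \<le> norm v"
      by (rule coefficient_bound_outside_span) blast
    show ?thesis
      unfolding closed_sequential_limits
    proof (intro allI impI, elim conjE)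
      fix v l
      assume "\<forall>n. v n \<in> complex_banach.span (insert b B)" and lim: "v \<longlonglongrightarrow> l"
      then obtain c where c: "\<And>n. v n - c n *\<^sub>C b \<in> complex_banach.span B"
        unfolding complex_banach.span_insert by auto metis
      have diff: "\<delta> * cmod (c m - c n) \<le> norm (v m - v n)" for m n
      proof (rule bound)
        have "(v m - c m *\<^sub>C b) - (v n - c n *\<^sub>C b) \<in> complex_banach.span B"
          by (rule complex_banach.span_diff[OF c c])
        then show "v m - v n - (c m - c n) *\<^sub>C b \<in> complex_banach.span B"
          by (simp add: complex_banach.scale_left_diff_distrib algebra_simps)
      qed
      have "Cauchy c"
      proof (rule metric_CauchyI)
        fix e :: real
        assume "e > 0"
        then have "\<delta> * e > 0"
          using \<delta> by simp
        then obtain M where M: "\<forall>m\<ge>M. \<forall>n\<ge>M. dist (v m) (v n) < \<delta> * e"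
          using LIMSEQ_imp_Cauchy[OF lim] metric_CauchyD by blast
        have "dist (c m) (c n) < e" if "m \<ge> M" "n \<ge> M" for m n
        proof -
          have "\<delta> * cmod (c m - c n) < \<delta> * e"
            using M that diff[of m n] by (force simp: dist_norm)
          then show ?thesis
            using \<delta> by (simp add: dist_norm)
        qed
        then show "\<exists>M. \<forall>m\<ge>M. \<forall>n\<ge>M. dist (c m) (c n) < e"
          by blast
      qed
      then obtain d where d: "c \<longlonglongrightarrow> d"
        using Cauchy_convergent convergent_def by blast
      have "(\<lambda>n. (c n - d) *\<^sub>C b) \<longlonglongrightarrow> 0"
      proof (rule tendsto_norm_zero_cancel)
        have "(\<lambda>n. cmod (c n - d) * norm b) \<longlonglongrightarrow> 0"
          using d by (auto intro!: tendsto_mult_left_zero tendsto_norm_zero simp: LIM_zero_iff)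
        then show "(\<lambda>n. norm ((c n - d) *\<^sub>C b)) \<longlonglongrightarrow> 0"
          by (simp add: norm_scaleC)
      qed
      from tendsto_diff[OF lim this]
      have "(\<lambda>n. (v n - c n *\<^sub>C b) + d *\<^sub>C b) \<longlonglongrightarrow> l"
        by (simp add: complex_banach.scale_left_diff_distrib algebra_simps)
      from tendsto_diff[OF this tendsto_const[of "d *\<^sub>C b"]]
      have "(\<lambda>n. v n - c n *\<^sub>C b) \<longlonglongrightarrow> l - d *\<^sub>C b"
        by simp
      then have "l - d *\<^sub>C b \<in> complex_banach.span B"
        by (rule closed_sequentially[OF insert.IH c])
      then show "l \<in> complex_banach.span (insert b B)"
        unfolding complex_banach.span_insert by blast
    qed
  qed
qed simp

text \<open>Lists are used because the order of the terms, their prefixes and their repetition all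
  matter later.\<close>

definition rank_one_sum :: "('a::complex_banach \<times> ('a \<Rightarrow> complex)) list \<Rightarrow> 'a \<Rightarrow> 'a" where
  "rank_one_sum l x = (\<Sum>p\<leftarrow>l. rank_one (fst p) (snd p) x)"

lemma rank_one_sum_simps [simp]:
  "rank_one_sum [] x = 0"
  "rank_one_sum (p # l) x = rank_one (fst p) (snd p) x + rank_one_sum l x"
  "rank_one_sum (l @ l') x = rank_one_sum l x + rank_one_sum l' x"
  by (simp_all add: rank_one_sum_def)

lemma linear_rank_one:
  assumes "g \<in> dual_space"
  shows "Vector_Spaces.linear scaleC scaleC (rank_one y g)"
proof -
  have "g (a + b) = g a + g b" "g (c *\<^sub>C a) = c * g a" for a b c
    using assms by (auto simp: dual_space_def linear_simps)
  then show ?thesis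
    by unfold_locales (simp_all add: rank_one_def scaleC_add_left scaleC_scaleC)
qed

lemma linear_sum_rank_one:
  assumes "\<And>i. i \<in> I \<Longrightarrow> g i \<in> dual_space"
  shows "Vector_Spaces.linear scaleC scaleC (\<lambda>x. \<Sum>i\<in>I. rank_one (y i) (g i) x)"
proof -
  have "rank_one (y i) (g i) (a + b) = rank_one (y i) (g i) a + rank_one (y i) (g i) b"
    "rank_one (y i) (g i) (c *\<^sub>C a) = c *\<^sub>C rank_one (y i) (g i) a" if "i \<in> I" for i a b c
    using linear_rank_one[OF assms[OF that]] by (simp_all add: Vector_Spaces.linear_iff)
  then show ?thesis
    by unfold_locales (simp_all add: sum.distrib complex_banach.scale_sum_right)
qed

text \<open>Induction on the spanning set with \<open>T\<close> and \<open>K\<close> arbitrary: the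
  coefficient \<open>c\<close> of the new vector \<open>b\<close> in \<open>T x\<close> is a bounded
  functional, and removing \<open>rank_one b c\<close> leaves a bounded linear map into the smaller
  span.\<close>

lemma bounded_finite_rank_eq_rank_one_sum:
  fixes T :: "'a::complex_banach \<Rightarrow> 'a"
  assumes "finite B" and "range T \<subseteq> complex_banach.span B"
    and "Vector_Spaces.linear scaleC scaleC T" and "\<And>x. norm (T x) \<le> K * norm x"
  shows "\<exists>l. (\<forall>p\<in>set l. snd p \<in> dual_space) \<and> (\<forall>x. T x = rank_one_sum l x)"
  using assms
proof (induction B arbitrary: T K)
  case empty
  then have "\<forall>x. T x = rank_one_sum [] x"
    by auto
  then show ?case
    by (metis empty_iff empty_set)
next
  case (insert b B)
  show ?case
  proof (cases "b \<in> complex_banach.span B")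
    case True
    with insert.prems(1) have "range T \<subseteq> complex_banach.span B"
      by (simp add: complex_banach.span_redundant)
    with insert.IH[of T K] insert.prems show ?thesis
      by blast
  next
    case False
    obtain \<delta> where \<delta>: "\<delta> > 0"
      and bound: "\<And>c v. v - c *\<^sub>C b \<in> complex_banach.span B \<Longrightarrow> \<delta> * cmod c \<le> norm v"
      using coefficient_bound_outside_span[OF closed_span_finite[OF insert.hyps(1)] False] by blast
    have "\<forall>x. \<exists>k. T x - k *\<^sub>C b \<in> complex_banach.span B"
      using insert.prems(1) unfolding complex_banach.span_insert by blast
    then obtain c where c: "\<And>x. T x - c x *\<^sub>C b \<in> complex_banach.span B"
      by metis
    \<comment> \<open>The estimate \<open>bound\<close> at \<open>v = 0\<close> forces two
      coefficients of the same vector to agree; this is what makes the chosen \<open>c\<close>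
      linear.\<close>
    have uniq: "c x = k" if "T x - k *\<^sub>C b \<in> complex_banach.span B" for x k
    proof -
      have "(T x - c x *\<^sub>C b) - (T x - k *\<^sub>C b) \<in> complex_banach.span B"
        by (rule complex_banach.span_diff[OF c that])
      then have "0 - (c x - k) *\<^sub>C b \<in> complex_banach.span B"
        by (simp add: complex_banach.scale_left_diff_distrib algebra_simps)
      from bound[OF this] show ?thesis
        using \<delta> by (simp add: mult_le_0_iff)
    qed
    have T_add: "T (x + y) = T x + T y" and T_scale: "T (k *\<^sub>C x) = k *\<^sub>C T x" for x y k
      using insert.prems(2) by (simp_all add: Vector_Spaces.linear_iff)
    have c_add: "c (x + y) = c x + c y" for x y
    proof (rule uniq)
      show "T (x + y) - (c x + c y) *\<^sub>C b \<in> complex_banach.span B"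
        using complex_banach.span_add[OF c[of x] c[of y]]
        by (simp add: T_add scaleC_add_left algebra_simps)
    qed
    have c_scale: "c (k *\<^sub>C x) = k * c x" for k x
    proof (rule uniq)
      show "T (k *\<^sub>C x) - (k * c x) *\<^sub>C b \<in> complex_banach.span B"
        using complex_banach.span_scale[OF c[of x], of k]
        by (simp add: T_scale complex_banach.scale_right_diff_distrib)
    qed
    have c_bound: "cmod (c x) \<le> norm x * (K / \<delta>)" for x
    proof -
      have "\<delta> * cmod (c x) \<le> K * norm x"
        using bound[OF c[of x]] insert.prems(3)[of x] by linarith
      then show ?thesis
        using \<delta> by (simp add: field_simps)
    qed
    have "bounded_linear c"
    proof (rule bounded_linear_intro[OF c_add _ c_bound])
      show "c (r *\<^sub>R x) = r *\<^sub>R c x" for r x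
        using c_scale[of "of_real r" x] by (simp add: scaleC_of_real scaleR_conv_of_real)
    qed
    then have dual: "c \<in> dual_space"
      by (simp add: dual_space_def c_scale)
    define T' where "T' x = T x - c x *\<^sub>C b" for x
    have "Vector_Spaces.linear scaleC scaleC T'"
      by unfold_locales
        (simp_all add: T'_def T_add T_scale c_add c_scale scaleC_add_left
          complex_banach.scale_right_diff_distrib)
    moreover have "norm (T' x) \<le> (K + K / \<delta> * norm b) * norm x" for x
    proof -
      have "norm (T' x) \<le> norm (T x) + cmod (c x) * norm b"
        unfolding T'_def by (metis norm_scaleC norm_triangle_ineq4)
      also have "\<dots> \<le> K * norm x + (norm x * (K / \<delta>)) * norm b"
        by (intro add_mono mult_right_mono insert.prems c_bound) simp
      finally show ?thesis
        by (simp add: algebra_simps)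
    qed
    moreover have "range T' \<subseteq> complex_banach.span B"
      using c by (auto simp: T'_def)
    ultimately obtain l where l: "\<forall>p\<in>set l. snd p \<in> dual_space" "\<forall>x. T' x = rank_one_sum l x"
      using insert.IH by blast
    have "T x = rank_one_sum ((b, c) # l) x" for x
      using l(2)[rule_format, of x] by (simp add: T'_def rank_one_def algebra_simps)
    with l(1) dual show ?thesis
      by (intro exI[of _ "(b, c) # l"]) auto
  qed
qed

section \<open>Completely bounded maps\<close>

lemma mat_opnorm_bounds:
  assumes "\<And>v. v \<in> carrier_vec (dim_col A) \<Longrightarrow> l2_norm v \<le> 1 \<Longrightarrow> l2_norm (A *\<^sub>v v) \<le> a"
  shows "0 \<le> mat_opnorm A" and "mat_opnorm A \<le> a"
proof -
  let ?V = "{v \<in> carrier_vec (dim_col A). l2_norm v \<le> 1}"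
  have 0: "0\<^sub>v (dim_col A) \<in> ?V"
    by (simp add: l2_norm_def L2_set_def)
  \<comment> \<open>A real supremum is meaningful only for a set bounded above, so even
    nonnegativity, tested at the zero vector, relies on the bound \<open>a\<close>.\<close>
  have "bdd_above ((\<lambda>v. l2_norm (A *\<^sub>v v)) ` ?V)"
    using assms by (auto intro!: bdd_aboveI[of _ a])
  then have "l2_norm (A *\<^sub>v 0\<^sub>v (dim_col A)) \<le> mat_opnorm A"
    unfolding mat_opnorm_def by (rule cSUP_upper[OF 0])
  then show "0 \<le> mat_opnorm A"
    by (rule order_trans[rotated]) (simp add: l2_norm_def)
  show "mat_opnorm A \<le> a"
    unfolding mat_opnorm_def by (rule cSUP_least) (use 0 in blast, use assms in blast)
qed

lemma mat_opnorm_one: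
  "0 \<le> mat_opnorm (1\<^sub>m n)" "mat_opnorm (1\<^sub>m n) \<le> 1"
  by (rule mat_opnorm_bounds[of "1\<^sub>m n" 1]; simp)+

text \<open>This is the Cauchy-Schwarz inequality.\<close>

lemma mat_opnorm_row:
  assumes "w \<in> carrier_vec n"
  shows "0 \<le> mat_opnorm (mat 1 n (\<lambda>(i, j). w $ j))"
    and "mat_opnorm (mat 1 n (\<lambda>(i, j). w $ j)) \<le> l2_norm w"
proof -
  let ?A = "mat 1 n (\<lambda>(i, j). w $ j)"
  have bound: "l2_norm (?A *\<^sub>v v) \<le> l2_norm w"
    if v: "v \<in> carrier_vec (dim_col ?A)" and v1: "l2_norm v \<le> 1" for v
  proof -
    have "l2_norm (?A *\<^sub>v v) = cmod (\<Sum>j<n. w $ j * v $ j)"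
      using v by (simp add: l2_norm_def L2_set_def scalar_prod_def atLeast0LessThan)
    also have "\<dots> \<le> (\<Sum>j<n. \<bar>cmod (w $ j)\<bar> * \<bar>cmod (v $ j)\<bar>)"
      by (rule order_trans[OF norm_sum]) (simp add: norm_mult)
    also have "\<dots> \<le> l2_norm w * l2_norm v"
      using v assms L2_set_mult_ineq[of "\<lambda>j. cmod (w $ j)" "\<lambda>j. cmod (v $ j)" "{..<n}"]
      by (simp add: l2_norm_def)
    also have "\<dots> \<le> l2_norm w"
      using v1 by (intro mult_left_le) (simp_all add: l2_norm_def)
    finally show ?thesis .
  qed
  show "0 \<le> mat_opnorm ?A" "mat_opnorm ?A \<le> l2_norm w"
    using mat_opnorm_bounds[OF bound] by auto
qed

text \<open>The argument is a single scalar of modulus at most 1, and the image is that multiple of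
  \<open>w\<close>.\<close>

lemma mat_opnorm_col:
  assumes "w \<in> carrier_vec n"
  shows "0 \<le> mat_opnorm (mat n 1 (\<lambda>(i, j). w $ i))"
    and "mat_opnorm (mat n 1 (\<lambda>(i, j). w $ i)) \<le> l2_norm w"
proof -
  let ?A = "mat n 1 (\<lambda>(i, j). w $ i)"
  have bound: "l2_norm (?A *\<^sub>v v) \<le> l2_norm w"
    if v: "v \<in> carrier_vec (dim_col ?A)" and v1: "l2_norm v \<le> 1" for v
  proof -
    have v0: "cmod (v $ 0) \<le> 1"
      using v v1 by (simp add: l2_norm_def L2_set_def)
    have "l2_norm (?A *\<^sub>v v) = L2_set (\<lambda>i. cmod (w $ i * v $ 0)) {..<n}"
      using v unfolding l2_norm_def
      by (intro L2_set_cong) (simp_all add: scalar_prod_def)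
    also have "\<dots> \<le> L2_set (\<lambda>i. cmod (w $ i)) {..<n}"
      using v0 by (intro L2_set_mono) (simp_all add: norm_mult mult_left_le)
    finally show ?thesis
      using assms by (simp add: l2_norm_def)
  qed
  show "0 \<le> mat_opnorm ?A" "mat_opnorm ?A \<le> l2_norm w"
    using mat_opnorm_bounds[OF bound] by auto
qed

section \<open>Consequences of Ruan's axioms and calculus of completely bounded maps\<close>

context operator_space
begin

lemma mnorm_zero: "mnorm (0\<^sub>m n n) = 0"
  using mnorm_eq_0_iff[of "0\<^sub>m n n" n] by simp

text \<open>Positivity is not an axiom: it follows from the triangle inequality for \<open>x\<close>
  and its negative, which have equal norms and sum zero.\<close>

lemma mnorm_nonneg:
  assumes "x \<in> carrier_mat n n"
  shows "0 \<le> mnorm x"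
proof -
  have "x + map_mat (scaleC (-1)) x = 0\<^sub>m n n"
    using assms by (intro eq_matI) (auto simp: complex_banach.scale_minus_left)
  moreover have "mnorm (x + map_mat (scaleC (-1)) x) \<le> mnorm x + mnorm (map_mat (scaleC (-1)) x)"
    using assms by (intro mnorm_triangle) auto
  ultimately show ?thesis
    using assms by (simp add: mnorm_zero mnorm_scaleC)
qed

text \<open>The direct sum axiom is applied once per diagonal entry. Equality fails at
  \<open>n = 0\<close>, where the left side is 0. This matrix is the middle factor in
  \<open>ex_cb_bound_rank_one\<close>.\<close>

lemma mnorm_scalar_diagonal_le:
  "mnorm (mat n n (\<lambda>(i, j). if i = j then y else 0)) \<le> norm y"
proof (induction n)
  case 0
  have "mat 0 0 (\<lambda>(i, j). if i = j then y else 0) = 0\<^sub>m 0 0"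
    by (intro eq_matI) auto
  then show ?case
    by (simp add: mnorm_zero)
next
  case (Suc n)
  let ?D = "\<lambda>n. mat n n (\<lambda>(i, j). if i = j then y else 0)"
  have "?D (Suc n) = direct_sum_mat (mat 1 1 (\<lambda>_. y)) (?D n)"
    by (intro eq_matI) (auto simp: direct_sum_mat_def)
  also have "mnorm \<dots> = max (norm y) (mnorm (?D n))"
    by (subst mnorm_direct_sum[of _ 1 _ n]) (simp_all add: mnorm_1 del: One_nat_def)
  finally show ?case
    using Suc by simp
qed

text \<open>Bounded functionals are completely bounded: \<open>w\<^sup>* g\<^sub>n(x) v = g(w\<^sup>* x v)\<close> reduces the
  operator norm of \<open>g\<^sub>n(x)\<close> to a \<open>1 \<times> 1\<close> compression of \<open>x\<close>.\<close>

lemma mat_opnorm_map_functional: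
  assumes "g \<in> dual_space" and G: "\<And>a. cmod (g a) \<le> G * norm a" "0 \<le> G"
    and x: "x \<in> carrier_mat n n"
  shows "0 \<le> mat_opnorm (map_mat g x)" and "mat_opnorm (map_mat g x) \<le> G * mnorm x"
proof -
  have bl: "bounded_linear g" and g_scale: "\<And>c a. g (c *\<^sub>C a) = c * g a"
    using assms(1) by (auto simp: dual_space_def)
  have bound: "l2_norm (map_mat g x *\<^sub>v v) \<le> G * mnorm x"
    if "v \<in> carrier_vec (dim_col (map_mat g x))" and v1: "l2_norm v \<le> 1" for v
  proof -
    have v: "v \<in> carrier_vec n"
      using that(1) x by simp
    \<comment> \<open>Testing against the image of \<open>v\<close> itself makes the pairing return
      the square of the norm to be estimated.\<close>
    define w where "w = map_mat g x *\<^sub>v v"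
    have w: "w \<in> carrier_vec n"
      using x by (simp add: w_def carrier_vecI)
    have w_nth: "w $ k = (\<Sum>l<n. g (x $$ (k, l)) * v $ l)" if "k < n" for k
      using x v that by (simp add: w_def scalar_prod_def atLeast0LessThan)
    define r where "r = mat 1 n (\<lambda>(i, j). vec n (\<lambda>k. cnj (w $ k)) $ j)"
    define s where "s = mat n 1 (\<lambda>(i, j). v $ i)"
    define a where "a = (\<Sum>k<n. \<Sum>l<n. (cnj (w $ k) * v $ l) *\<^sub>C (x $$ (k, l)))"
    have l2_cnj: "l2_norm (vec n (\<lambda>k. cnj (w $ k))) = l2_norm w"
      using w unfolding l2_norm_def by (intro L2_set_cong) auto
    have "bimod_mult r x s = mat 1 1 (\<lambda>_. a)"
      using x by (intro eq_matI) (auto simp: bimod_mult_def r_def s_def a_def intro!: sum.cong)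
    then have "norm a = mnorm (bimod_mult r x s)"
      by (simp add: mnorm_1 del: One_nat_def)
    also have "\<dots> \<le> mat_opnorm r * mnorm x * mat_opnorm s"
      by (rule mnorm_bimod_mult[OF x, of _ 1]) (simp_all add: r_def s_def)
    also have "\<dots> \<le> l2_norm w * mnorm x * 1"
    proof (intro mult_mono)
      show "mat_opnorm r \<le> l2_norm w"
        unfolding r_def l2_cnj[symmetric] by (rule mat_opnorm_row) simp
      show "mat_opnorm s \<le> 1" "0 \<le> mat_opnorm s"
        unfolding s_def using mat_opnorm_col[OF v] v1 by linarith+
    qed (use mnorm_nonneg[OF x] in \<open>simp_all add: l2_norm_def\<close>)
    finally have a: "norm a \<le> l2_norm w * mnorm x"
      by simp
    have "of_real ((l2_norm w)\<^sup>2) = (\<Sum>k<n. cnj (w $ k) * w $ k)"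
      using w by (simp add: l2_norm_def L2_set_def sum_nonneg complex_norm_square mult.commute
          del: of_real_power)
    also have "\<dots> = (\<Sum>k<n. \<Sum>l<n. g ((cnj (w $ k) * v $ l) *\<^sub>C (x $$ (k, l))))"
    proof (intro sum.cong refl)
      fix k
      assume "k \<in> {..<n}"
      then have "w $ k = (\<Sum>l<n. g (x $$ (k, l)) * v $ l)"
        by (simp add: w_nth)
      from arg_cong[OF this, of "(*) (cnj (w $ k))"]
      show "cnj (w $ k) * w $ k = (\<Sum>l<n. g ((cnj (w $ k) * v $ l) *\<^sub>C (x $$ (k, l))))"
        by (simp only: g_scale sum_distrib_left mult_ac)
    qed
    also have "\<dots> = g a"
      by (simp add: a_def linear_sum[OF bounded_linear.linear[OF bl]])
    finally have "(l2_norm w)\<^sup>2 = cmod (g a)"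
      by (metis norm_of_real abs_power2)
    also have "\<dots> \<le> G * (l2_norm w * mnorm x)"
      using G(1)[of a] mult_left_mono[OF a G(2)] by linarith
    finally have "l2_norm w * l2_norm w \<le> l2_norm w * (G * mnorm x)"
      by (simp add: power2_eq_square mult_ac)
    \<comment> \<open>One factor \<open>l2_norm w\<close> cancels; if it is 0, the claim is
      nonnegativity of the right side.\<close>
    then show ?thesis
      using G(2) mnorm_nonneg[OF x] unfolding w_def[symmetric]
      by (cases "l2_norm w = 0") (auto simp: l2_norm_def mult_le_cancel_left order.strict_iff_order)
  qed
  show "0 \<le> mat_opnorm (map_mat g x)" "mat_opnorm (map_mat g x) \<le> G * mnorm x"
    using mat_opnorm_bounds[OF bound] by auto
qed

text \<open>A homogeneous, real-valued form of a bound on the cb-norm, so that sums and multiples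
  can be estimated without \<open>ennreal\<close>. The next two lemmas translate both ways for
  linear maps and \<open>C \<ge> 0\<close>.\<close>

definition cb_bound :: "real \<Rightarrow> ('a \<Rightarrow> 'a) \<Rightarrow> bool" where
  "cb_bound C \<phi> \<longleftrightarrow> (\<forall>n. \<forall>x\<in>carrier_mat n n. mnorm (map_mat \<phi> x) \<le> C * mnorm x)"

lemma cb_bound_imp_cb_norm_le:
  assumes "cb_bound C \<phi>" and "0 \<le> C"
  shows "cb_norm mnorm mnorm \<phi> \<le> ennreal C"
  unfolding cb_norm_def amp_norm_def
proof (intro SUP_least ennreal_leI)
  fix n x
  assume "x \<in> {x \<in> carrier_mat n n. mnorm x \<le> 1}"
  then have x: "x \<in> carrier_mat n n" "mnorm x \<le> 1"
    by auto
  have "mnorm (map_mat \<phi> x) \<le> C * mnorm x"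
    using assms(1) x(1) by (auto simp: cb_bound_def)
  also have "\<dots> \<le> C"
    using x(2) assms(2) by (rule mult_left_le)
  finally show "mnorm (map_mat \<phi> x) \<le> C" .
qed

text \<open>Rescaling to norm 1 reduces to the unit ball, by homogeneity of \<phi>. The zero matrix
  cannot be rescaled and is treated apart.\<close>

lemma cb_norm_le_imp_cb_bound:
  assumes lin: "Vector_Spaces.linear scaleC scaleC \<phi>"
    and le: "cb_norm mnorm mnorm \<phi> \<le> ennreal C" and "0 \<le> C"
  shows "cb_bound C \<phi>"
  unfolding cb_bound_def
proof (intro allI ballI)
  fix n and x :: "'a mat"
  assume x: "x \<in> carrier_mat n n"
  have scale: "\<phi> (c *\<^sub>C a) = c *\<^sub>C \<phi> a" for c a
    using lin by (simp add: Vector_Spaces.linear_iff)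
  show "mnorm (map_mat \<phi> x) \<le> C * mnorm x"
  proof (cases "mnorm x = 0")
    case True
    then have "x = 0\<^sub>m n n"
      using mnorm_eq_0_iff[OF x] by simp
    moreover have "\<phi> 0 = 0"
      using scale[of 0 0] by simp
    ultimately have "map_mat \<phi> x = 0\<^sub>m n n"
      by (intro eq_matI) auto
    with True show ?thesis
      by (simp add: mnorm_zero)
  next
    case False
    with mnorm_nonneg[OF x] have pos: "mnorm x > 0"
      by simp
    define y where "y = map_mat (scaleC (of_real (inverse (mnorm x)))) x"
    have y: "y \<in> carrier_mat n n"
      using x by (simp add: y_def)
    have "mnorm y = 1"
      using pos unfolding y_def by (subst mnorm_scaleC[OF x]) (simp add: norm_inverse)
    then have "ennreal (mnorm (map_mat \<phi> y)) \<le> amp_norm mnorm mnorm n \<phi>"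
      unfolding amp_norm_def using y by (intro SUP_upper) auto
    also have "\<dots> \<le> cb_norm mnorm mnorm \<phi>"
      unfolding cb_norm_def by (rule SUP_upper) simp
    finally have "mnorm (map_mat \<phi> y) \<le> C"
      using le \<open>0 \<le> C\<close> by (meson ennreal_le_iff order_trans)
    also have "map_mat \<phi> y = map_mat (scaleC (of_real (inverse (mnorm x)))) (map_mat \<phi> x)"
      using x by (intro eq_matI) (auto simp: y_def scale)
    also have "mnorm \<dots> = inverse (mnorm x) * mnorm (map_mat \<phi> x)"
      using x pos by (subst mnorm_scaleC[of _ n]) (auto simp: norm_inverse)
    finally show ?thesis
      using pos by (simp add: field_simps)
  qed
qed

text \<open>The 1 by 1 matrices carry the norm of the space itself.\<close>

lemma cb_bound_imp_norm_le:
  assumes "cb_bound C \<phi>"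
  shows "norm (\<phi> a) \<le> C * norm a"
proof -
  have "map_mat \<phi> (mat 1 1 (\<lambda>_. a)) = mat 1 1 (\<lambda>_. \<phi> a)"
    by (intro eq_matI) auto
  moreover have "mnorm (map_mat \<phi> (mat 1 1 (\<lambda>_. a))) \<le> C * mnorm (mat 1 1 (\<lambda>_. a))"
    using assms unfolding cb_bound_def by (metis mat_carrier)
  ultimately show ?thesis
    by (simp add: mnorm_1 del: One_nat_def)
qed

lemma cb_bound_mono:
  assumes "cb_bound C \<phi>" and "C \<le> D"
  shows "cb_bound D \<phi>"
  using assms unfolding cb_bound_def by (meson mnorm_nonneg mult_right_mono order_trans)

lemma cb_bound_zero: "cb_bound 0 (\<lambda>x. 0)"
proof -
  have "map_mat (\<lambda>x. 0) x = 0\<^sub>m n n" if "x \<in> carrier_mat n n" for x :: "'a mat" and n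
    using that by (intro eq_matI) auto
  then show ?thesis
    unfolding cb_bound_def by (metis mnorm_zero mult_zero_left order_refl)
qed

lemma cb_bound_add:
  assumes "cb_bound C \<phi>" and "cb_bound D \<psi>"
  shows "cb_bound (C + D) (\<lambda>x. \<phi> x + \<psi> x)"
  unfolding cb_bound_def
proof (intro allI ballI)
  fix n and x :: "'a mat"
  assume x: "x \<in> carrier_mat n n"
  have "map_mat (\<lambda>x. \<phi> x + \<psi> x) x = map_mat \<phi> x + map_mat \<psi> x"
    by (intro eq_matI) auto
  also have "mnorm \<dots> \<le> mnorm (map_mat \<phi> x) + mnorm (map_mat \<psi> x)"
    using x by (intro mnorm_triangle[of _ n]) auto
  also have "\<dots> \<le> C * mnorm x + D * mnorm x"
    using assms x unfolding cb_bound_def by (blast intro: add_mono)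
  finally show "mnorm (map_mat (\<lambda>x. \<phi> x + \<psi> x) x) \<le> (C + D) * mnorm x"
    by (simp add: algebra_simps)
qed

lemma cb_bound_diff:
  assumes "cb_bound C \<phi>" and "cb_bound D \<psi>"
  shows "cb_bound (C + D) (\<lambda>x. \<phi> x - \<psi> x)"
  unfolding cb_bound_def
proof (intro allI ballI)
  fix n and x :: "'a mat"
  assume x: "x \<in> carrier_mat n n"
  have "map_mat (\<lambda>x. \<phi> x - \<psi> x) x = map_mat \<phi> x + map_mat (scaleC (-1)) (map_mat \<psi> x)"
    by (intro eq_matI) (auto simp: complex_banach.scale_minus_left)
  also have "mnorm \<dots> \<le> mnorm (map_mat \<phi> x) + mnorm (map_mat (scaleC (-1)) (map_mat \<psi> x))"
    using x by (intro mnorm_triangle[of _ n]) auto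
  also have "mnorm (map_mat (scaleC (-1)) (map_mat \<psi> x)) = mnorm (map_mat \<psi> x)"
    using x by (subst mnorm_scaleC[of _ n]) auto
  also have "mnorm (map_mat \<phi> x) + mnorm (map_mat \<psi> x) \<le> C * mnorm x + D * mnorm x"
    using assms x unfolding cb_bound_def by (blast intro: add_mono)
  finally show "mnorm (map_mat (\<lambda>x. \<phi> x - \<psi> x) x) \<le> (C + D) * mnorm x"
    by (simp add: algebra_simps)
qed

lemma cb_bound_scaleR:
  assumes "cb_bound C \<phi>" and "0 \<le> r"
  shows "cb_bound (r * C) (\<lambda>x. r *\<^sub>R \<phi> x)"
  unfolding cb_bound_def
proof (intro allI ballI)
  fix n and x :: "'a mat"
  assume x: "x \<in> carrier_mat n n"
  have "map_mat (\<lambda>x. r *\<^sub>R \<phi> x) x = map_mat (scaleC (of_real r)) (map_mat \<phi> x)"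
    by (intro eq_matI) (auto simp: scaleC_of_real)
  also have "mnorm \<dots> = r * mnorm (map_mat \<phi> x)"
    using x assms(2) by (subst mnorm_scaleC[of _ n]) auto
  also have "\<dots> \<le> r * (C * mnorm x)"
    using assms x unfolding cb_bound_def by (blast intro: mult_left_mono)
  finally show "mnorm (map_mat (\<lambda>x. r *\<^sub>R \<phi> x) x) \<le> r * C * mnorm x"
    by (simp add: mult.assoc)
qed

text \<open>The amplification at \<open>x\<close> factors as \<open>map_mat g x\<close> times the
  diagonal matrix of \<open>y\<close> times the identity. Ruan's bimodule axiom then reduces the
  claim to the complete boundedness of \<open>g\<close>.\<close>

lemma ex_cb_bound_rank_one:
  assumes g: "g \<in> dual_space"
  shows "\<exists>C\<ge>0. cb_bound C (rank_one y g)"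
proof -
  obtain G where G: "\<And>a. cmod (g a) \<le> G * norm a" "0 \<le> G"
    using g bounded_linear.nonneg_bounded[of g] by (auto simp: dual_space_def mult.commute)
  have "cb_bound (G * norm y) (rank_one y g)"
    unfolding cb_bound_def
  proof (intro allI ballI)
    fix n and x :: "'a mat"
    assume x: "x \<in> carrier_mat n n"
    let ?D = "mat n n (\<lambda>(i, j). if i = j then y else 0)"
    have "map_mat (rank_one y g) x = bimod_mult (map_mat g x) ?D (1\<^sub>m n)"
      (is "?L = ?R")
    proof (rule eq_matI)
      fix i j
      assume "i < dim_row ?R" "j < dim_col ?R"
      then have ij: "i < n" "j < n"
        using x by (auto simp: bimod_mult_def)
      have "?R $$ (i, j) = (\<Sum>k<n. \<Sum>l<n. (map_mat g x $$ (i, k) * 1\<^sub>m n $$ (l, j)) *\<^sub>C ?D $$ (k, l))"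
        using x ij by (simp add: bimod_mult_def)
      \<comment> \<open>The identity matrix selects \<open>l = j\<close>, the diagonal matrix
        \<open>k = l\<close>.\<close>
      also have "\<dots> = (\<Sum>k<n. \<Sum>l<n. if l = j then if k = j then g (x $$ (i, k)) *\<^sub>C y else 0 else 0)"
        by (intro sum.cong refl) (use x ij in auto)
      also have "\<dots> = (\<Sum>k<n. if k = j then g (x $$ (i, k)) *\<^sub>C y else 0)"
        using ij by simp
      also have "\<dots> = ?L $$ (i, j)"
        using x ij by (simp add: rank_one_def)
      finally show "?L $$ (i, j) = ?R $$ (i, j)"
        by simp
    qed (use x in \<open>auto simp: bimod_mult_def\<close>)
    also have "mnorm \<dots> \<le> mat_opnorm (map_mat g x) * mnorm ?D * mat_opnorm (1\<^sub>m n)"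
      using x by (intro mnorm_bimod_mult[of _ n]) auto
    also have "\<dots> \<le> (G * mnorm x) * norm y * 1"
      using mat_opnorm_map_functional[OF g G x] mat_opnorm_one[of n] mnorm_nonneg[OF x] G(2)
        mnorm_scalar_diagonal_le[of n y] mnorm_nonneg[of ?D n]
      by (intro mult_mono) auto
    finally show "mnorm (map_mat (rank_one y g) x) \<le> G * norm y * mnorm x"
      by (simp add: mult_ac)
  qed
  then show ?thesis
    using G(2) by (intro exI[of _ "G * norm y"]) auto
qed

text \<open>Adding up the constants of the single terms serves all prefixes at once. The result may
  be large: it will be divided by the number of repetitions.\<close>

lemma ex_cb_bound_partial_rank_one_sums:
  assumes "\<forall>p\<in>set l. snd p \<in> dual_space"
  shows "\<exists>C\<ge>0. \<forall>r. cb_bound C (rank_one_sum (take r l))"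
  using assms
proof (induction l)
  case Nil
  have "rank_one_sum [] = (\<lambda>x. 0::'a)"
    by auto
  then show ?case
    using cb_bound_zero by (intro exI[of _ 0]) simp
next
  case (Cons p l)
  then obtain C where C: "C \<ge> 0" "\<And>r. cb_bound C (rank_one_sum (take r l))"
    by auto
  obtain D where D: "D \<ge> 0" "cb_bound D (rank_one (fst p) (snd p))"
    using ex_cb_bound_rank_one[of "snd p" "fst p"] Cons.prems by auto
  have "cb_bound (D + C) (rank_one_sum (take r (p # l)))" for r
  proof (cases r)
    case 0
    have "rank_one_sum [] = (\<lambda>x. 0::'a)"
      by auto
    with 0 show ?thesis
      using cb_bound_mono[OF cb_bound_zero, of "D + C"] C D by simp
  next
    case (Suc r')
    have "rank_one_sum (p # take r' l) =
        (\<lambda>x. rank_one (fst p) (snd p) x + rank_one_sum (take r' l) x)"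
      by auto
    then show ?thesis
      using cb_bound_add[OF D(2) C(2)[of r']] Suc by simp
  qed
  then show ?case
    using C D by (intro exI[of _ "D + C"]) auto
qed

end

section \<open>From the CBAP to a frame\<close>

text \<open>An interrupted run splits into \<open>s\<close> complete passes, which yield a multiple
  of the full map, and one broken pass, which becomes the error.\<close>

lemma take_concat_replicate:
  "\<exists>s r. s \<le> N \<and> take j (concat (replicate N l)) = concat (replicate s l) @ take r l"
proof (induction N arbitrary: j)
  case (Suc N)
  show ?case
  proof (cases "j \<le> length l")
    case True
    then show ?thesis
      by (intro exI[of _ 0] exI[of _ j]) simp
  next
    case False
    obtain s r where "s \<le> N"
      "take (j - length l) (concat (replicate N l)) = concat (replicate s l) @ take r l"
      using Suc.IH by blast
    with False show ?thesis
      by (intro exI[of _ "Suc s"] exI[of _ r]) simp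
  qed
qed (intro exI[of _ 0], simp)

lemma rank_one_sum_concat_replicate:
  "rank_one_sum (concat (replicate s l)) x = real s *\<^sub>R rank_one_sum l x"
  by (induction s) (simp_all add: scaleR_add_left)

lemma rank_one_sum_map_scaleR:
  "rank_one_sum (map (\<lambda>(y, g). (t *\<^sub>R y, g)) l) x = t *\<^sub>R rank_one_sum l x"
  by (induction l) (auto simp: rank_one_def scaleC_scaleR scaleR_add_right)

text \<open>Running \<open>N\<close> times through \<open>1/N\<close> of a rank-one decomposition of \<open>A\<close> (Pelczynski's trick)
  keeps the partial sums within \<open>O(1/N)\<close> of the segment from \<open>0\<close> to \<open>A\<close>.\<close>

lemma (in operator_space) ex_rank_one_list_near_segment:
  assumes A: "finite_rank A" "cb_bound C A" and "\<epsilon> > 0"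
  shows "\<exists>l. l \<noteq> [] \<and> (\<forall>p\<in>set l. snd p \<in> dual_space) \<and> (\<forall>x. rank_one_sum l x = A x) \<and>
    (\<forall>j. \<exists>t D. 0 \<le> t \<and> t \<le> 1 \<and> cb_bound \<epsilon> D \<and> (\<forall>x. rank_one_sum (take j l) x = t *\<^sub>R A x + D x))"
proof -
  obtain B where "finite B" "range A \<subseteq> complex_banach.span B"
    and "Vector_Spaces.linear scaleC scaleC A"
    using A(1) by (auto simp: finite_rank_def)
  from bounded_finite_rank_eq_rank_one_sum[OF this cb_bound_imp_norm_le[OF A(2)]]
  obtain l0 where l0: "\<forall>p\<in>set l0. snd p \<in> dual_space" "\<And>x. A x = rank_one_sum l0 x"
    by blast
  \<comment> \<open>The zero term changes no value but keeps the list non-empty, as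
    \<open>ex_infinite_concat\<close> requires of its blocks.\<close>
  define l where "l = (0, \<lambda>_. 0) # l0"
  have l: "\<forall>p\<in>set l. snd p \<in> dual_space" "l \<noteq> []" "\<And>x. rank_one_sum l x = A x"
    using l0 by (auto simp: l_def dual_space_def rank_one_def)
  obtain M where M: "M \<ge> 0" "\<And>r. cb_bound M (rank_one_sum (take r l))"
    using ex_cb_bound_partial_rank_one_sums[OF l(1)] by blast
  \<comment> \<open>\<open>M\<close> bounds every prefix of one pass, so scaling by
    \<open>1 / N\<close> brings a broken pass below \<epsilon>.\<close>
  obtain N where N: "real N > M / \<epsilon>"
    using reals_Archimedean2 by blast
  moreover have "M / \<epsilon> \<ge> 0"
    using M \<open>\<epsilon> > 0\<close> by simp
  ultimately have "real N > 0"
    by linarith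
  define l1 where "l1 = map (\<lambda>(y, g). ((1 / real N) *\<^sub>R y, g)) l"
  define L where "L = concat (replicate N l1)"
  have l1: "rank_one_sum (take r l1) x = (1 / real N) *\<^sub>R rank_one_sum (take r l) x" for r x
    unfolding l1_def take_map by (rule rank_one_sum_map_scaleR)
  have l1_A: "rank_one_sum l1 x = (1 / real N) *\<^sub>R A x" for x
    using l1[of "length l1" x] l(3) by (simp add: l1_def)
  have "L \<noteq> []"
    using \<open>real N > 0\<close> l(2) by (cases N) (auto simp: L_def l1_def)
  moreover have "\<forall>p\<in>set L. snd p \<in> dual_space"
    using l(1) by (auto simp: L_def l1_def)
  moreover have "rank_one_sum L x = A x" for x
    using \<open>real N > 0\<close> by (simp add: L_def rank_one_sum_concat_replicate l1_A)
  moreover have "\<exists>t D. 0 \<le> t \<and> t \<le> 1 \<and> cb_bound \<epsilon> D \<and>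
      (\<forall>x. rank_one_sum (take j L) x = t *\<^sub>R A x + D x)" for j
  proof -
    \<comment> \<open>The witnesses are \<open>s / N\<close> for \<open>t\<close> and the scaled
      broken pass for \<open>D\<close>.\<close>
    obtain s r where "s \<le> N" and sr: "take j L = concat (replicate s l1) @ take r l1"
      using take_concat_replicate unfolding L_def by blast
    have "cb_bound (1 / real N * M) (\<lambda>x. (1 / real N) *\<^sub>R rank_one_sum (take r l) x)"
      by (rule cb_bound_scaleR[OF M(2)]) simp
    moreover have "1 / real N * M \<le> \<epsilon>"
      using N \<open>real N > 0\<close> \<open>\<epsilon> > 0\<close> by (simp add: field_simps)
    ultimately have "cb_bound \<epsilon> (\<lambda>x. (1 / real N) *\<^sub>R rank_one_sum (take r l) x)"
      by (rule cb_bound_mono)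
    moreover have "rank_one_sum (take j L) x =
        (real s / real N) *\<^sub>R A x + (1 / real N) *\<^sub>R rank_one_sum (take r l) x" for x
      by (simp add: sr rank_one_sum_concat_replicate l1 l1_A)
    moreover have "0 \<le> real s / real N" "real s / real N \<le> 1"
      using \<open>s \<le> N\<close> \<open>real N > 0\<close> by auto
    ultimately show ?thesis
      by blast
  qed
  ultimately show ?thesis
    by blast
qed

text \<open>The finite concatenations extend one another and, with non-empty blocks, grow without
  bound, so they have a limit sequence. The length condition on \<open>k\<close> is what later
  forces \<open>k\<close> to be large when \<open>m\<close> is.\<close>

lemma ex_infinite_concat:
  fixes L :: "nat \<Rightarrow> 'b list"
  assumes "\<And>k. L k \<noteq> []"
  shows "\<exists>F. (\<forall>n. \<exists>k. F n \<in> set (L k)) \<and>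
    (\<forall>m. \<exists>k j. map F [0..<m] = concat (map L [0..<k]) @ take j (L k)
       \<and> m < length (concat (map L [0..<Suc k])))"
proof -
  define P where "P k = concat (map L [0..<k])" for k
  have P_Suc: "P (Suc k) = P k @ L k" for k
    by (simp add: P_def)
  have len: "k \<le> length (P k)" for k
  proof (induction k)
    case (Suc k)
    moreover have "length (L k) > 0"
      using assms by simp
    ultimately show ?case
      unfolding P_Suc length_append by linarith
  qed simp
  have P_nth: "P k ! n = P l ! n" if "k \<le> l" "n < length (P k)" for k l n
    using that
  proof (induction l rule: dec_induct)
    case (step l)
    have "length (P k) \<le> length (P l)"
      using step.hyps(1) by (induction l rule: dec_induct) (auto simp: P_Suc)
    with step show ?case
      by (auto simp: P_Suc nth_append)
  qed simp
  \<comment> \<open>The first \<open>n + 1\<close> blocks have at least \<open>n + 1\<close>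
    entries, so index \<open>n\<close> is in range.\<close>
  define F where "F n = P (Suc n) ! n" for n
  have F_eq: "F n = P k ! n" if "n < length (P k)" for n k
  proof (cases "k \<le> Suc n")
    case True
    from P_nth[OF this that] show ?thesis
      by (simp add: F_def)
  next
    case False
    then show ?thesis
      unfolding F_def using len[of "Suc n"] by (intro P_nth) simp_all
  qed
  have "\<exists>k. F n \<in> set (L k)" for n
  proof -
    have "F n \<in> set (P (Suc n))"
      unfolding F_def using len[of "Suc n"] by (intro nth_mem) simp
    then show ?thesis
      by (auto simp: P_def)
  qed
  moreover have "\<exists>k j. map F [0..<m] = P k @ take j (L k) \<and> m < length (P (Suc k))" for m
  proof -
    \<comment> \<open>This is the block containing index \<open>m\<close>; by minimality the blocks
      before it have at most \<open>m\<close> entries.\<close>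
    define k where "k = (LEAST k. m < length (P (Suc k)))"
    have k: "m < length (P (Suc k))"
      unfolding k_def by (rule LeastI[of _ m]) (use len[of "Suc m"] in simp)
    have "length (P k) \<le> m"
    proof (cases k)
      case (Suc k')
      then show ?thesis
        using not_less_Least[of k' "\<lambda>k. m < length (P (Suc k))"] by (simp add: k_def)
    qed (simp add: P_def)
    then have "take m (P (Suc k)) = P k @ take (m - length (P k)) (L k)"
      by (simp add: P_Suc)
    moreover have "map F [0..<m] = take m (P (Suc k))"
      using k by (intro nth_equalityI) (auto simp: F_eq)
    ultimately show ?thesis
      using k by auto
  qed
  ultimately show ?thesis
    unfolding P_def by blast
qed

section \<open>Construction of the frame from the approximating maps\<close>

lemma finite_rank_zero: "finite_rank (\<lambda>x. 0)"
  unfolding finite_rank_def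
  by (auto intro!: exI[of _ "{}"] simp: Vector_Spaces.linear_iff complex_banach.vector_space_axioms)

lemma finite_rank_diff:
  assumes "finite_rank \<Phi>" and "finite_rank \<Psi>"
  shows "finite_rank (\<lambda>x. \<Phi> x - \<Psi> x)"
proof -
  obtain B B' where B: "finite B" "range \<Phi> \<subseteq> complex_banach.span B"
    and B': "finite B'" "range \<Psi> \<subseteq> complex_banach.span B'"
    using assms by (auto simp: finite_rank_def)
  have "\<Phi> x - \<Psi> x \<in> complex_banach.span (B \<union> B')" for x
    using B(2) B'(2) complex_banach.span_mono[of B "B \<union> B'"] complex_banach.span_mono[of B' "B \<union> B'"]
    by (intro complex_banach.span_diff) auto
  then have "\<exists>S. finite S \<and> range (\<lambda>x. \<Phi> x - \<Psi> x) \<subseteq> complex_banach.span S"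
    using B(1) B'(1) by (intro exI[of _ "B \<union> B'"]) auto
  moreover have "Vector_Spaces.linear scaleC scaleC (\<lambda>x. \<Phi> x - \<Psi> x)"
    using assms unfolding finite_rank_def
    by (auto simp: Vector_Spaces.linear_iff complex_banach.scale_right_diff_distrib)
  ultimately show ?thesis
    by (simp add: finite_rank_def)
qed

lemma (in operator_space) CBAP_imp_cb_frame:
  assumes "CBAP mnorm"
  shows "\<exists>F. cb_frame mnorm F"
proof -
  obtain \<Phi> where fin: "\<And>k. finite_rank (\<Phi> k)" and sup: "(SUP k. cb_norm mnorm mnorm (\<Phi> k)) < \<infinity>"
    and lim: "\<And>x. (\<lambda>k. \<Phi> k x) \<longlonglongrightarrow> x"
    using assms unfolding CBAP_def by blast
  define C where "C = enn2real (SUP k. cb_norm mnorm mnorm (\<Phi> k))"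
  have "C \<ge> 0"
    by (simp add: C_def)
  have "cb_norm mnorm mnorm (\<Phi> k) \<le> ennreal C" for k
    using sup SUP_upper[of k UNIV] by (simp add: C_def)
  then have \<Phi>_bound: "cb_bound C (\<Phi> k)" for k
    using fin \<open>C \<ge> 0\<close> cb_norm_le_imp_cb_bound by (simp add: finite_rank_def)
  \<comment> \<open>The shift by one with \<open>\<Psi> 0 = 0\<close> lets the differences telescope
    exactly to \<open>\<Psi> k\<close>.\<close>
  define \<Psi> where "\<Psi> k = (case k of 0 \<Rightarrow> (\<lambda>x. 0) | Suc k' \<Rightarrow> \<Phi> k')" for k
  have \<Psi>_fin: "finite_rank (\<Psi> k)" for k
    by (cases k) (simp_all add: \<Psi>_def fin finite_rank_zero)
  have \<Psi>_bound: "cb_bound C (\<Psi> k)" for k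
    by (cases k) (simp_all add: \<Psi>_def \<Phi>_bound cb_bound_mono[OF cb_bound_zero \<open>C \<ge> 0\<close>])
  have \<Psi>_lim: "(\<lambda>k. \<Psi> k x) \<longlonglongrightarrow> x" for x
    using lim[of x] by (subst filterlim_sequentially_Suc[symmetric]) (simp add: \<Psi>_def)
  define A where "A k x = \<Psi> (Suc k) x - \<Psi> k x" for k x
  have A_fin: "finite_rank (A k)" for k
    unfolding A_def by (rule finite_rank_diff[OF \<Psi>_fin \<Psi>_fin])
  have "cb_bound (C + C) (A k)" for k
  proof -
    from cb_bound_diff[OF \<Psi>_bound \<Psi>_bound] show ?thesis
      by (simp add: A_def[abs_def])
  qed
  \<comment> \<open>The tolerance \<open>1 / (k + 1)\<close> is at most 1, for the uniform cb-bound,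
    and tends to 0, for convergence.\<close>
  from ex_rank_one_list_near_segment[OF A_fin this, of "inverse (real (Suc k))" for k]
  have "\<forall>k. \<exists>l. l \<noteq> [] \<and> (\<forall>p\<in>set l. snd p \<in> dual_space) \<and> (\<forall>x. rank_one_sum l x = A k x) \<and>
    (\<forall>j. \<exists>t D. 0 \<le> t \<and> t \<le> 1 \<and> cb_bound (inverse (real (Suc k))) D \<and>
      (\<forall>x. rank_one_sum (take j l) x = t *\<^sub>R A k x + D x))"
    by simp
  then obtain L where L: "\<And>k. L k \<noteq> []" "\<And>k p. p \<in> set (L k) \<Longrightarrow> snd p \<in> dual_space"
    "\<And>k x. rank_one_sum (L k) x = A k x"
    "\<And>k j. \<exists>t D. 0 \<le> t \<and> t \<le> 1 \<and> cb_bound (inverse (real (Suc k))) D \<and>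
      (\<forall>x. rank_one_sum (take j (L k)) x = t *\<^sub>R A k x + D x)"
    by metis
  obtain F where F_dual: "\<And>n. \<exists>k. F n \<in> set (L k)"
    and F_map: "\<And>m. \<exists>k j. map F [0..<m] = concat (map L [0..<k]) @ take j (L k)
       \<and> m < length (concat (map L [0..<Suc k]))"
    using ex_infinite_concat[of L, OF L(1)] by blast
  have F_sum: "(\<Sum>n<m. rank_one (fst (F n)) (snd (F n)) x) = rank_one_sum (map F [0..<m]) x" for m x
    by (induction m) simp_all
  have telescope: "rank_one_sum (concat (map L [0..<k])) x = \<Psi> k x" for k x
    by (induction k) (simp_all add: L(3) A_def, simp add: \<Psi>_def)
  \<comment> \<open>The completed blocks sum to \<open>\<Psi> k\<close>; adding the fraction
    \<open>t\<close> of the next difference gives a convex combination of \<open>\<Psi> k\<close>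
    and \<open>\<Psi> (Suc k)\<close>, up to the error \<open>D\<close>.\<close>
  have partial: "\<exists>k t D. 0 \<le> t \<and> t \<le> 1 \<and> cb_bound (inverse (real (Suc k))) D \<and>
      m < length (concat (map L [0..<Suc k])) \<and>
      (\<forall>x. (\<Sum>n<m. rank_one (fst (F n)) (snd (F n)) x) =
        ((1 - t) *\<^sub>R \<Psi> k x + t *\<^sub>R \<Psi> (Suc k) x) + D x)" for m
  proof -
    obtain k j where kj: "map F [0..<m] = concat (map L [0..<k]) @ take j (L k)"
      "m < length (concat (map L [0..<Suc k]))"
      using F_map by blast
    obtain t D where "0 \<le> t" "t \<le> 1" "cb_bound (inverse (real (Suc k))) D"
      and "\<And>x. rank_one_sum (take j (L k)) x = t *\<^sub>R A k x + D x"
      using L(4) by blast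
    moreover from this(4)
    have "\<forall>x. (\<Sum>n<m. rank_one (fst (F n)) (snd (F n)) x) =
        ((1 - t) *\<^sub>R \<Psi> k x + t *\<^sub>R \<Psi> (Suc k) x) + D x"
      unfolding F_sum kj by (simp add: telescope A_def algebra_simps)
    ultimately show ?thesis
      using kj(2) by blast
  qed
  have "cb_frame mnorm F"
    unfolding cb_frame_def
  proof (intro conjI allI)
    show "snd (F n) \<in> dual_space" for n
      using F_dual L(2) by blast
  next
    \<comment> \<open>The convex combination contributes \<open>C\<close> and the error at most
      1.\<close>
    have "cb_norm mnorm mnorm (\<lambda>x. \<Sum>n<m. rank_one (fst (F n)) (snd (F n)) x) \<le> ennreal (C + 1)" for m
    proof -
      obtain k t D where t: "0 \<le> t" "t \<le> 1" and D: "cb_bound (inverse (real (Suc k))) D"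
        and eq: "\<And>x. (\<Sum>n<m. rank_one (fst (F n)) (snd (F n)) x) =
          ((1 - t) *\<^sub>R \<Psi> k x + t *\<^sub>R \<Psi> (Suc k) x) + D x"
        using partial[of m] by blast
      have "cb_bound 1 D"
        by (rule cb_bound_mono[OF D]) (simp add: field_simps)
      have "cb_bound (((1 - t) * C + t * C) + 1)
          (\<lambda>x. ((1 - t) *\<^sub>R \<Psi> k x + t *\<^sub>R \<Psi> (Suc k) x) + D x)"
        using t \<Psi>_bound \<open>cb_bound 1 D\<close> by (intro cb_bound_add cb_bound_scaleR) auto
      then show ?thesis
        using \<open>C \<ge> 0\<close> by (intro cb_bound_imp_cb_norm_le) (simp_all add: eq algebra_simps)
    qed
    then have "(SUP m. cb_norm mnorm mnorm (\<lambda>x. \<Sum>n<m. rank_one (fst (F n)) (snd (F n)) x))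
        \<le> ennreal (C + 1)"
      by (rule SUP_least)
    then show "(SUP m. cb_norm mnorm mnorm (\<lambda>x. \<Sum>n<m. rank_one (fst (F n)) (snd (F n)) x)) < \<infinity>"
      by (rule le_less_trans) simp
  next
    fix x
    have "(\<lambda>m. \<Sum>n<m. rank_one (fst (F n)) (snd (F n)) x) \<longlonglongrightarrow> x"
    proof (rule metric_LIMSEQ_I)
      fix e :: real
      assume "e > 0"
      \<comment> \<open>Half of \<open>e\<close> is for the convex combination, half for
        \<open>D x\<close>, whose norm is at most \<open>norm x / (k + 1)\<close>.\<close>
      then obtain K1 where K1: "\<And>k. k \<ge> K1 \<Longrightarrow> norm (\<Psi> k x - x) < e / 2"
        using LIMSEQ_D[OF \<Psi>_lim, of "e / 2" x] by auto
      have "(\<lambda>k. inverse (real (Suc k)) * norm x) \<longlonglongrightarrow> 0"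
        by (rule tendsto_mult_left_zero[OF LIMSEQ_inverse_real_of_nat])
      then obtain K2 where K2: "\<And>k. k \<ge> K2 \<Longrightarrow> inverse (real (Suc k)) * norm x < e / 2"
        using LIMSEQ_D[of _ 0 "e / 2"] \<open>e > 0\<close> by fastforce
      define K where "K = max K1 K2"
      have "dist (\<Sum>n<m. rank_one (fst (F n)) (snd (F n)) x) x < e"
        if m: "m \<ge> length (concat (map L [0..<K]))" for m
      proof -
        obtain k t D where t: "0 \<le> t" "t \<le> 1" and D: "cb_bound (inverse (real (Suc k))) D"
          and k: "m < length (concat (map L [0..<Suc k]))"
          and eq: "(\<Sum>n<m. rank_one (fst (F n)) (snd (F n)) x) =
            ((1 - t) *\<^sub>R \<Psi> k x + t *\<^sub>R \<Psi> (Suc k) x) + D x"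
          using partial[of m] by blast
        \<comment> \<open>Otherwise the first \<open>K\<close> blocks would include the first
          \<open>k + 1\<close>, which already have more than \<open>m\<close> entries.\<close>
        have "k \<ge> K"
        proof (rule ccontr)
          assume "\<not> k \<ge> K"
          then have "[0..<K] = [0..<Suc k] @ [Suc k..<K]"
            using upt_add_eq_append[of 0 "Suc k" "K - Suc k"] by (simp del: upt_Suc)
          then show False
            using m k by (simp del: upt_Suc)
        qed
        \<comment> \<open>The weights \<open>1 - t\<close> and \<open>t\<close> add to 1, so
          \<open>x\<close> can be distributed over both terms.\<close>
        have "dist (\<Sum>n<m. rank_one (fst (F n)) (snd (F n)) x) x =
            norm ((1 - t) *\<^sub>R (\<Psi> k x - x) + t *\<^sub>R (\<Psi> (Suc k) x - x) + D x)"
          by (simp add: eq dist_norm algebra_simps)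
        also have "\<dots> \<le> (1 - t) * norm (\<Psi> k x - x) + t * norm (\<Psi> (Suc k) x - x) + norm (D x)"
          using t by (intro order_trans[OF norm_triangle_ineq] add_mono) auto
        also have "\<dots> \<le> (1 - t) * (e / 2) + t * (e / 2) + inverse (real (Suc k)) * norm x"
          using t K1[of k] K1[of "Suc k"] \<open>k \<ge> K\<close> cb_bound_imp_norm_le[OF D, of x]
          by (intro add_mono mult_left_mono) (auto simp: K_def)
        also have "\<dots> = e / 2 + inverse (real (Suc k)) * norm x"
          by (simp add: field_simps)
        also have "\<dots> < e"
          using K2[of k] \<open>k \<ge> K\<close> by (simp add: K_def)
        finally show ?thesis .
      qed
      then show "\<exists>M. \<forall>m\<ge>M. dist (\<Sum>n<m. rank_one (fst (F n)) (snd (F n)) x) x < e"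
        by blast
    qed
    then show "(\<lambda>n. snd (F n) x *\<^sub>C fst (F n)) sums x"
      by (simp add: sums_def rank_one_def)
  qed
  then show ?thesis
    by blast
qed

section \<open>From a frame to the CBAP\<close>

lemma cb_frame_imp_CBAP:
  assumes "cb_frame N F"
  shows "CBAP N"
proof -
  \<comment> \<open>The uniform bound and the convergence are clauses of \<open>cb_frame\<close>;
    what remains is that each partial sum has finite rank.\<close>
  define S where "S m x = (\<Sum>n<m. rank_one (fst (F n)) (snd (F n)) x)" for m x
  have F: "\<And>n. snd (F n) \<in> dual_space" "\<And>x. (\<lambda>n. snd (F n) x *\<^sub>C fst (F n)) sums x"
    and sup: "(SUP m. cb_norm N N (S m)) < \<infinity>"
    using assms by (auto simp: cb_frame_def S_def[abs_def])
  have "finite_rank (S m)" for m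
  proof -
    have "Vector_Spaces.linear scaleC scaleC (S m)"
      unfolding S_def by (rule linear_sum_rank_one) (rule F)
    moreover have "S m x \<in> complex_banach.span (fst ` F ` {..<m})" for x
      unfolding S_def rank_one_def
      by (intro complex_banach.span_sum complex_banach.span_scale complex_banach.span_base) auto
    ultimately show ?thesis
      unfolding finite_rank_def by (auto intro!: exI[of _ "fst ` F ` {..<m}"])
  qed
  moreover have "(\<lambda>m. S m x) \<longlonglongrightarrow> x" for x
    using F(2)[of x] by (simp add: sums_def S_def rank_one_def)
  ultimately show ?thesis
    using sup unfolding CBAP_def by blast
qed

theorem theorem3p1:
  fixes mnorm :: "'a::complex_banach mat \<Rightarrow> real"
  assumes "operator_space mnorm"
    and "separable_space (euclidean :: 'a topology)"
  shows "(\<exists>F :: nat \<Rightarrow> 'a \<times> ('a \<Rightarrow> complex). cb_frame mnorm F) \<longleftrightarrow> CBAP mnorm"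
  using cb_frame_imp_CBAP operator_space.CBAP_imp_cb_frame[OF assms(1)] by blast

end
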